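(* Let $H$ be a (real) mixed Hodge structure. Then $\alpha(H)\ge0$.
   Context: A real mixed Hodge structure $H$ is a finite-dimensional real vector space $H_{\mathbf R}$ with an increasing exhaustive filtration $W_\bullet$ and a decreasing exhaustive filtration $F^\bullet$ on $H_{\mathbf C}=H_{\mathbf R}\otimes\mathbf C$, with conjugate $\overline F^\bullet$, such that $Gr_F^pGr_{\overline F}^qGr^W_nH_{\mathbf C}=0$ if $p+q\ne n$. The level of $\mathbf R$-splitting of $H$ is $\alpha(H)=\frac12\sum_{p,q}(p+q)^2(h_H^{p,q}-s_H^{p,q})$, where $h_H^{p,q}=\dim_{\mathbf C}Gr_{\overline F}^qGr_F^pGr^W_{p+q}H_{\mathbf C}$ and $s_H^{p,q}=\dim_{\mathbf C}Gr_F^pGr_{\overline F}^qH_{\mathbf C}$. *)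

theory Defs
  imports Complex_Main "HOL-Library.Product_Plus" "HOL-Library.Set_Algebras"
begin

section \<open>Complexification of a real vector space\<close>

text \<open>
  The complexification of the real vector space \<open>'a\<close> is carried by \<open>'a \<times> 'a\<close>, the pair \<open>(x, y)\<close>
  standing for \<open>x \<otimes> 1 + y \<otimes> \<i>\<close>.
\<close>

definition cscale :: "complex \<Rightarrow> 'a::real_vector \<times> 'a \<Rightarrow> 'a \<times> 'a" where
  "cscale c v = (Re c *\<^sub>R fst v - Im c *\<^sub>R snd v, Re c *\<^sub>R snd v + Im c *\<^sub>R fst v)"

definition conjug :: "'a::real_vector \<times> 'a \<Rightarrow> 'a \<times> 'a" where
  "conjug v = (fst v, - snd v)"

global_interpretation cplx: vector_space "cscale :: complex \<Rightarrow> 'a::real_vector \<times> 'a \<Rightarrow> 'a \<times> 'a"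
  by unfold_locales (simp_all add: cscale_def prod_eq_iff algebra_simps)

definition complexify :: "'a::real_vector set \<Rightarrow> ('a \<times> 'a) set" where
  "complexify U = U \<times> U"

section \<open>Subquotients and graded pieces\<close>

text \<open>
  A pair \<open>(A, B)\<close> of subspaces with \<open>B \<subseteq> A\<close> stands for the subquotient \<open>A / B\<close>; it is the zero
  space iff \<open>A = B\<close>.  A subspace \<open>U\<close> of the ambient space induces on \<open>A / B\<close> the subspace
  \<open>((U \<inter> A) + B) / B\<close> (the sum of sets is taken elementwise).  Hence a filtration \<open>F\<close> induces a
  filtration on \<open>A / B\<close>, and the operators below return its graded pieces, again as subquotients.
\<close>

type_synonym 'a subquotient = "('a \<times> 'a) set \<times> ('a \<times> 'a) set"

definition induced :: "('a::real_vector \<times> 'a) set \<Rightarrow> 'a subquotient \<Rightarrow> ('a \<times> 'a) set" where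
  "induced U Q = (U \<inter> fst Q) + snd Q"

definition gr_dec :: "(int \<Rightarrow> ('a::real_vector \<times> 'a) set) \<Rightarrow> int \<Rightarrow> 'a subquotient \<Rightarrow> 'a subquotient" where
  "gr_dec F p Q = (induced (F p) Q, induced (F (p + 1)) Q)"

definition gr_inc :: "(int \<Rightarrow> ('a::real_vector \<times> 'a) set) \<Rightarrow> int \<Rightarrow> 'a subquotient \<Rightarrow> 'a subquotient" where
  "gr_inc W n Q = (induced (W n) Q, induced (W (n - 1)) Q)"

definition whole :: "'a::real_vector subquotient" where
  "whole = (UNIV, {0})"

definition sq_zero :: "'a::real_vector subquotient \<Rightarrow> bool" where
  "sq_zero Q \<longleftrightarrow> fst Q = snd Q"

text \<open>
  The dimension of \<open>A / B\<close> is the number of elements of any \<open>S \<subseteq> A\<close> whose classes modulo \<open>B\<close> form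
  a basis of \<open>A / B\<close>; the lemma \<open>sq_dim_eq\<close> below shows that it is \<open>dim A - dim B\<close>.
\<close>

definition sq_basis :: "('a::real_vector \<times> 'a) set \<Rightarrow> 'a subquotient \<Rightarrow> bool" where
  "sq_basis S Q \<longleftrightarrow>
     S \<subseteq> fst Q \<and> cplx.span (S \<union> snd Q) = fst Q \<and>
     (\<forall>T u. finite T \<longrightarrow> T \<subseteq> S \<longrightarrow> (\<Sum>v\<in>T. cscale (u v) v) \<in> snd Q \<longrightarrow> (\<forall>v\<in>T. u v = 0))"

definition sq_dim :: "'a::real_vector subquotient \<Rightarrow> nat" where
  "sq_dim Q = card (SOME S. sq_basis S Q)"

section \<open>Real mixed Hodge structures\<close>

text \<open>
  Exhaustive filtrations are those with finitely many steps from the zero subspace to the whole space.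
\<close>

definition increasing_filtration :: "(int \<Rightarrow> 'a::real_vector set) \<Rightarrow> bool" where
  "increasing_filtration W \<longleftrightarrow>
     (\<forall>n. subspace (W n)) \<and> mono W \<and> (\<exists>n. W n = {0}) \<and> (\<exists>n. W n = UNIV)"

definition decreasing_filtration :: "(int \<Rightarrow> ('a::real_vector \<times> 'a) set) \<Rightarrow> bool" where
  "decreasing_filtration F \<longleftrightarrow>
     (\<forall>p. cplx.subspace (F p)) \<and> antimono F \<and> (\<exists>p. F p = UNIV) \<and> (\<exists>p. F p = {0})"

definition conj_filtration :: "(int \<Rightarrow> ('a::real_vector \<times> 'a) set) \<Rightarrow> int \<Rightarrow> ('a \<times> 'a) set" where
  "conj_filtration F q = conjug ` F q"

definition gr_W :: "(int \<Rightarrow> 'a::real_vector set) \<Rightarrow> int \<Rightarrow> 'a subquotient" where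
  "gr_W W n = gr_inc (\<lambda>k. complexify (W k)) n whole"

text \<open>The underlying real vector space is the type \<open>'a\<close> itself.\<close>

definition real_mixed_hodge_structure ::
    "(int \<Rightarrow> 'a::real_vector set) \<Rightarrow> (int \<Rightarrow> ('a \<times> 'a) set) \<Rightarrow> bool" where
  "real_mixed_hodge_structure W F \<longleftrightarrow>
     (\<exists>B :: 'a set. finite B \<and> span B = UNIV) \<and>
     increasing_filtration W \<and> decreasing_filtration F \<and>
     (\<forall>n p q. p + q \<noteq> n \<longrightarrow> sq_zero (gr_dec F p (gr_dec (conj_filtration F) q (gr_W W n))))"

definition hodge_h :: "(int \<Rightarrow> 'a::real_vector set) \<Rightarrow> (int \<Rightarrow> ('a \<times> 'a) set) \<Rightarrow> int \<Rightarrow> int \<Rightarrow> nat" where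
  "hodge_h W F p q = sq_dim (gr_dec (conj_filtration F) q (gr_dec F p (gr_W W (p + q))))"

definition hodge_s :: "(int \<Rightarrow> ('a::real_vector \<times> 'a) set) \<Rightarrow> int \<Rightarrow> int \<Rightarrow> nat" where
  "hodge_s F p q = sq_dim (gr_dec F p (gr_dec (conj_filtration F) q whole))"

text \<open>
  The sum runs over the pairs with a nonzero Hodge number; there are only finitely many of them by
  \<open>finite_hodge_support\<close> below.
\<close>

definition R_splitting_level ::
    "(int \<Rightarrow> 'a::real_vector set) \<Rightarrow> (int \<Rightarrow> ('a \<times> 'a) set) \<Rightarrow> real" where
  "R_splitting_level W F =
     (1 / 2) * (\<Sum>(p, q) \<in> {(p, q). hodge_h W F p q \<noteq> 0 \<or> hodge_s F p q \<noteq> 0}.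
        (of_int (p + q))\<^sup>2 * (real (hodge_h W F p q) - real (hodge_s F p q)))"

section \<open>Adequacy of the definitions\<close>

lemma finite_complexification:
  assumes "finite (B :: 'a::real_vector set)" "span B = UNIV"
  shows "\<exists>C :: ('a \<times> 'a) set. finite C \<and> cplx.span C = UNIV"
proof -
  let ?C = "(\<lambda>x. (x, 0 :: 'a)) ` B"
  have real: "(x, 0) \<in> cplx.span ?C" for x
  proof -
    have "x \<in> span B" using assms by simp
    then show ?thesis
    proof (induction rule: span_induct_alt)
      case base
      then show ?case using cplx.span_zero[of ?C] by (simp add: zero_prod_def)
    next
      case (step c x y)
      have "(x, 0) \<in> cplx.span ?C" using step(1) by (intro cplx.span_base) auto
      then have "cscale (complex_of_real c) (x, 0) + (y, 0) \<in> cplx.span ?C"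
        using step(2) by (intro cplx.span_add cplx.span_scale)
      moreover have "cscale (complex_of_real c) (x, 0) + (y, 0) = (c *\<^sub>R x + y, 0)"
        by (simp add: cscale_def)
      ultimately show ?case by simp
    qed
  qed
  have "(x, y) \<in> cplx.span ?C" for x y
  proof -
    have "(x, 0) + cscale \<i> (y, 0) \<in> cplx.span ?C"
      using real by (intro cplx.span_add cplx.span_scale)
    moreover have "(x, 0) + cscale \<i> (y, 0) = (x, y)" by (simp add: cscale_def)
    ultimately show ?thesis by simp
  qed
  then have "cplx.span ?C = UNIV" by auto
  then show ?thesis using assms by blast
qed

lemma sq_dim_eq:
  fixes A B :: "('a::real_vector \<times> 'a) set"
  assumes fin: "finite C" "cplx.span C = (UNIV :: ('a \<times> 'a) set)"
    and sub: "cplx.subspace A" "cplx.subspace B" "B \<subseteq> A"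
  shows "\<exists>S. sq_basis S (A, B)"
    and "sq_basis S (A, B) \<Longrightarrow> card S = cplx.dim A - cplx.dim B"
    and "sq_dim (A, B) = cplx.dim A - cplx.dim B"
proof -
  obtain BB where BB: "BB \<subseteq> B" "cplx.independent BB" "B \<subseteq> cplx.span BB" "card BB = cplx.dim B"
    using cplx.basis_exists[of B] by metis
  have spanBB: "cplx.span BB = B"
    using BB sub by (meson cplx.span_minimal subset_antisym)
  obtain BA where BA: "BB \<subseteq> BA" "BA \<subseteq> A" "cplx.independent BA" "A \<subseteq> cplx.span BA"
    using cplx.maximal_independent_subset_extend[of BB A] BB sub by blast
  show ex: "\<exists>S. sq_basis S (A, B)"
  proof (intro exI, unfold sq_basis_def fst_conv snd_conv, intro conjI allI impI)
    show "BA - BB \<subseteq> A" using BA by auto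
    have "A \<subseteq> cplx.span (BA - BB \<union> B)"
      using BA(4) cplx.span_mono[of BA "BA - BB \<union> B"] BB(1) by auto
    moreover have "cplx.span (BA - BB \<union> B) \<subseteq> A"
      using BA sub by (intro cplx.span_minimal) auto
    ultimately show "cplx.span (BA - BB \<union> B) = A" by blast
  next
    fix T u
    assume T: "finite T" "T \<subseteq> BA - BB" "(\<Sum>v\<in>T. cscale (u v) v) \<in> B"
    have finBA: "finite BA" using cplx.independent_span_bound[OF fin(1) BA(3)] fin by auto
    have finBB: "finite BB" using finBA BA(1) finite_subset by blast
    obtain w where w: "(\<Sum>v\<in>T. cscale (u v) v) = (\<Sum>v\<in>BB. cscale (w v) v)"
      using T(3) spanBB cplx.span_finite[OF finBB] by auto
    define z where "z = (\<lambda>v. if v \<in> T then u v else - w v)"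
    have "(\<Sum>v\<in>T \<union> BB. cscale (z v) v) = (\<Sum>v\<in>T. cscale (z v) v) + (\<Sum>v\<in>BB. cscale (z v) v)"
      using T finBB by (intro sum.union_disjoint) auto
    also have "(\<Sum>v\<in>T. cscale (z v) v) = (\<Sum>v\<in>T. cscale (u v) v)"
      by (simp add: z_def)
    also have "(\<Sum>v\<in>BB. cscale (z v) v) = (\<Sum>v\<in>BB. - cscale (w v) v)"
      using T by (intro sum.cong) (auto simp: z_def)
    finally have "(\<Sum>v\<in>T \<union> BB. cscale (z v) v) = 0"
      using w by (simp add: sum_negf)
    moreover have "finite (T \<union> BB)" "T \<union> BB \<subseteq> BA" using T finBB BA(1) by auto
    ultimately have "\<forall>v\<in>T \<union> BB. z v = 0"
      using BA(3) unfolding cplx.dependent_explicit by blast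
    then show "\<forall>v\<in>T. u v = 0" unfolding z_def by (metis UnI1)
  qed
  have card: "card S = cplx.dim A - cplx.dim B" if "sq_basis S (A, B)" for S
  proof -
    have S: "S \<subseteq> A" "cplx.span (S \<union> B) = A"
      and ind: "\<And>T u v. finite T \<Longrightarrow> T \<subseteq> S \<Longrightarrow> (\<Sum>v\<in>T. cscale (u v) v) \<in> B \<Longrightarrow> v \<in> T \<Longrightarrow> u v = 0"
      using that unfolding sq_basis_def by auto
    have disj: "S \<inter> BB = {}"
    proof (rule ccontr)
      assume "S \<inter> BB \<noteq> {}"
      then obtain v where "v \<in> S" "v \<in> BB" by blast
      then show False using ind[of "{v}" "\<lambda>_. 1" v] BB(1) by auto
    qed
    have indep: "cplx.independent (S \<union> BB)"
      unfolding cplx.dependent_explicit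
    proof (rule notI, elim exE conjE)
      fix t u
      assume t: "finite t" "t \<subseteq> S \<union> BB" "(\<Sum>v\<in>t. cscale (u v) v) = 0" "\<exists>v\<in>t. u v \<noteq> 0"
      have split: "(\<Sum>v\<in>t. cscale (u v) v) = (\<Sum>v\<in>t \<inter> S. cscale (u v) v) + (\<Sum>v\<in>t - S. cscale (u v) v)"
        using t(1) by (simp add: sum.Int_Diff)
      have inB: "(\<Sum>v\<in>t - S. cscale (u v) v) \<in> B"
        using t BB(1) sub(2) by (intro cplx.subspace_sum cplx.subspace_scale) auto
      have "(\<Sum>v\<in>t \<inter> S. cscale (u v) v) = - (\<Sum>v\<in>t - S. cscale (u v) v)"
        using split t(3) by (simp add: eq_neg_iff_add_eq_0)
      then have "(\<Sum>v\<in>t \<inter> S. cscale (u v) v) \<in> B"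
        using inB sub(2) by (simp add: cplx.subspace_neg)
      then have z: "\<forall>v\<in>t \<inter> S. u v = 0" using ind[of "t \<inter> S" u] t(1) by blast
      then have "(\<Sum>v\<in>t - S. cscale (u v) v) = 0" using split t(3) by simp
      moreover have "finite (t - S)" "t - S \<subseteq> BB" using t by auto
      ultimately have "\<forall>v\<in>t - S. u v = 0"
        using BB(2) unfolding cplx.dependent_explicit by blast
      then show False using z t(4) by blast
    qed
    have "B \<subseteq> cplx.span (S \<union> BB)" using spanBB cplx.span_mono[of BB "S \<union> BB"] by auto
    then have "A \<subseteq> cplx.span (S \<union> BB)"
      using S(2) cplx.span_minimal[OF _ cplx.subspace_span, of "S \<union> B" "S \<union> BB"]
        cplx.span_superset[of "S \<union> BB"] by auto
    then have "card (S \<union> BB) = cplx.dim A"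
      using indep S BB(1) sub(3) by (intro cplx.basis_card_eq_dim) auto
    moreover have "finite (S \<union> BB)" using cplx.independent_span_bound[OF fin(1) indep] fin by auto
    ultimately show ?thesis using disj BB(4) by (simp add: card_Un_disjoint)
  qed
  show "sq_basis S (A, B) \<Longrightarrow> card S = cplx.dim A - cplx.dim B" by (rule card)
  show "sq_dim (A, B) = cplx.dim A - cplx.dim B"
    unfolding sq_dim_def by (rule card[OF someI_ex[OF ex]])
qed

lemma sq_dim_zero:
  assumes "cplx.subspace (snd Q)" "sq_zero Q"
  shows "sq_dim Q = 0"
proof -
  have "S = {}" if "sq_basis S Q" for S
  proof (rule ccontr)
    assume "S \<noteq> {}"
    then obtain v where v: "v \<in> S" by blast
    then have "v \<in> snd Q" using that assms unfolding sq_basis_def sq_zero_def by auto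
    moreover have "(\<Sum>w\<in>{v}. cscale (u w) w) \<in> snd Q \<longrightarrow> (\<forall>w\<in>{v}. u w = 0)" for u
      using that v unfolding sq_basis_def by (meson empty_subsetI finite.simps insert_subset)
    from this[of "\<lambda>_. 1"] have "v \<in> snd Q \<longrightarrow> (1 :: complex) = 0" by simp
    ultimately show False by simp
  qed
  moreover have "cplx.span (snd Q) = snd Q"
    using assms(1) by (simp add: cplx.span_eq_iff)
  then have "sq_basis {} Q"
    using assms(2) by (simp add: sq_basis_def sq_zero_def)
  then have "sq_basis (SOME S. sq_basis S Q) Q" by (rule someI)
  ultimately have "(SOME S. sq_basis S Q) = {}" by blast
  then show ?thesis
    unfolding sq_dim_def by simp
qed

lemma subspace_induced:
  assumes "cplx.subspace U" "cplx.subspace (fst Q)" "cplx.subspace (snd Q)"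
  shows "cplx.subspace (induced U Q)"
proof -
  have "induced U Q = {x + y |x y. x \<in> U \<inter> fst Q \<and> y \<in> snd Q}"
    unfolding induced_def set_plus_def by blast
  then show ?thesis
    using cplx.subspace_sums[OF cplx.subspace_inter[OF assms(1,2)] assms(3)] by simp
qed

lemma subspace_complexify: "subspace U \<Longrightarrow> cplx.subspace (complexify U)"
  unfolding cplx.subspace_def
  by (auto simp: complexify_def cscale_def zero_prod_def subspace_0 subspace_add subspace_diff subspace_scale)

lemma subspace_conjug:
  assumes "cplx.subspace U"
  shows "cplx.subspace (conjug ` U)"
  unfolding cplx.subspace_def
proof (intro conjI ballI allI)
  show "0 \<in> conjug ` U"
    using cplx.subspace_0[OF assms] by (intro image_eqI[of _ _ 0]) (auto simp: conjug_def zero_prod_def)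
next
  fix x y assume "x \<in> conjug ` U" "y \<in> conjug ` U"
  then obtain a b where ab: "a \<in> U" "b \<in> U" "x = conjug a" "y = conjug b" by blast
  then have "x + y = conjug (a + b)" by (simp add: conjug_def prod_eq_iff)
  then show "x + y \<in> conjug ` U" using ab cplx.subspace_add[OF assms] by blast
next
  fix c x assume "x \<in> conjug ` U"
  then obtain a where a: "a \<in> U" "x = conjug a" by blast
  then have "cscale c x = conjug (cscale (cnj c) a)"
    by (simp add: conjug_def cscale_def prod_eq_iff algebra_simps)
  then show "cscale c x \<in> conjug ` U" using a cplx.subspace_scale[OF assms] by blast
qed

lemma decreasing_filtration_conj:
  assumes "decreasing_filtration F"
  shows "decreasing_filtration (conj_filtration F)"
proof -
  have inv: "conjug (conjug v) = v" for v :: "'a \<times> 'a" by (simp add: conjug_def)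
  have "conjug ` UNIV = (UNIV :: ('a \<times> 'a) set)" by (metis inv surj_def)
  moreover have "conjug ` {0} = {0 :: 'a \<times> 'a}" by (simp add: conjug_def zero_prod_def)
  moreover obtain a b where "F a = UNIV" "F b = {0}"
    using assms unfolding decreasing_filtration_def by blast
  ultimately have "conj_filtration F a = UNIV" "conj_filtration F b = {0}"
    by (simp_all add: conj_filtration_def)
  moreover have "\<forall>p. cplx.subspace (conj_filtration F p)"
    using assms subspace_conjug unfolding decreasing_filtration_def conj_filtration_def by blast
  moreover have "antimono (conj_filtration F)"
    using assms unfolding decreasing_filtration_def conj_filtration_def antimono_def
    by (simp add: image_mono)
  ultimately show ?thesis unfolding decreasing_filtration_def by blast
qed

lemma filtration_jumps:
  assumes "decreasing_filtration F"
  obtains a b where "\<And>p. p < a \<or> b < p \<Longrightarrow> F p = F (p + 1)"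
proof -
  from assms obtain a b where ab: "F a = UNIV" "F b = {0}" and anti: "antimono F"
    and sub: "\<And>p. cplx.subspace (F p)"
    unfolding decreasing_filtration_def by blast
  have "F p = UNIV" if "p \<le> a" for p using antimonoD[OF anti that] ab by blast
  moreover have "F p = {0}" if "b \<le> p" for p
    using antimonoD[OF anti that] ab cplx.subspace_0[OF sub[of p]] by blast
  ultimately have "F p = F (p + 1)" if "p < a \<or> b < p" for p using that by auto
  then show thesis using that by blast
qed

lemma induced_trivial:
  assumes "cplx.subspace U" "cplx.subspace A"
  shows "induced U (A, A) = A"
proof -
  have "x + y \<in> A" if "x \<in> U \<inter> A" "y \<in> A" for x y
    using that cplx.subspace_add[OF assms(2)] by simp
  moreover have "\<exists>x\<in>U \<inter> A. \<exists>z\<in>A. y = x + z" if "y \<in> A" for y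
    using that cplx.subspace_0[OF assms(1)] cplx.subspace_0[OF assms(2)]
    by (intro bexI[of _ 0] bexI[of _ y]) auto
  ultimately show ?thesis
    unfolding induced_def set_plus_def by auto
qed

lemma finite_support_gr_gr:
  assumes "decreasing_filtration F" "decreasing_filtration G"
    and "\<And>n. cplx.subspace (fst (Q n))" "\<And>n. cplx.subspace (snd (Q n))"
  shows "finite {(p, q). sq_dim (gr_dec F p (gr_dec G q (Q (p + q)))) \<noteq> 0}"
proof -
  obtain a b where ab: "\<And>p. p < a \<or> b < p \<Longrightarrow> F p = F (p + 1)"
    using filtration_jumps[OF assms(1)] by blast
  obtain c d where cd: "\<And>p. p < c \<or> d < p \<Longrightarrow> G p = G (p + 1)"
    using filtration_jumps[OF assms(2)] by blast
  have sF: "\<And>p. cplx.subspace (F p)" and sG: "\<And>p. cplx.subspace (G p)"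
    using assms(1,2) unfolding decreasing_filtration_def by auto
  have sub: "cplx.subspace (induced (G q) (Q n))" for q n
    using subspace_induced sG assms(3,4) by blast
  have zero: "sq_dim (gr_dec F p (gr_dec G q (Q n))) = 0"
    if "F p = F (p + 1) \<or> G q = G (q + 1)" for p q n
  proof (rule sq_dim_zero)
    show "cplx.subspace (snd (gr_dec F p (gr_dec G q (Q n))))"
      unfolding gr_dec_def snd_conv by (intro subspace_induced sF) (simp_all add: sub)
    show "sq_zero (gr_dec F p (gr_dec G q (Q n)))"
      using that
    proof
      assume "G q = G (q + 1)"
      then show ?thesis
        unfolding gr_dec_def sq_zero_def fst_conv snd_conv
        using induced_trivial[OF sF sub] by simp
    qed (simp add: gr_dec_def sq_zero_def)
  qed
  have "p \<in> {a..b} \<and> q \<in> {c..d}" if "sq_dim (gr_dec F p (gr_dec G q (Q (p + q)))) \<noteq> 0" for p q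
  proof -
    have "F p \<noteq> F (p + 1)" "G q \<noteq> G (q + 1)" using that zero by metis+
    then show ?thesis using ab[of p] cd[of q] by force
  qed
  then have "{(p, q). sq_dim (gr_dec F p (gr_dec G q (Q (p + q)))) \<noteq> 0} \<subseteq> {a..b} \<times> {c..d}"
    by blast
  moreover have "finite ({a..b} \<times> {c..d})" by simp
  ultimately show ?thesis using finite_subset by blast
qed

lemma finite_hodge_support:
  assumes "real_mixed_hodge_structure W F"
  shows "finite {(p, q). hodge_h W F p q \<noteq> 0 \<or> hodge_s F p q \<noteq> 0}"
proof -
  have F: "decreasing_filtration F" and W: "\<And>n. subspace (W n)"
    using assms unfolding real_mixed_hodge_structure_def increasing_filtration_def by auto
  have G: "decreasing_filtration (conj_filtration F)" by (rule decreasing_filtration_conj[OF F])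
  have whole: "cplx.subspace (fst (whole :: 'a subquotient))" "cplx.subspace (snd (whole :: 'a subquotient))"
    by (simp_all add: whole_def cplx.subspace_UNIV cplx.subspace_single_0)
  have gW: "cplx.subspace (fst (gr_W W n))" "cplx.subspace (snd (gr_W W n))" for n
    unfolding gr_W_def gr_inc_def fst_conv snd_conv
    by (intro subspace_induced subspace_complexify W whole)+
  have h: "finite {(q, p). hodge_h W F p q \<noteq> 0}"
    using finite_support_gr_gr[OF G F, of "gr_W W"] gW by (simp add: hodge_h_def add.commute)
  have s: "finite {(p, q). hodge_s F p q \<noteq> 0}"
    using finite_support_gr_gr[OF F G, of "\<lambda>_. whole"] whole by (simp add: hodge_s_def)
  have "{(p, q). hodge_h W F p q \<noteq> 0 \<or> hodge_s F p q \<noteq> 0} \<subseteq>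
      prod.swap ` {(q, p). hodge_h W F p q \<noteq> 0} \<union> {(p, q). hodge_s F p q \<noteq> 0}"
    by force
  then show ?thesis using h s by (meson finite_UnI finite_imageI finite_subset)
qed

end

theory Submission
  imports Defs
begin

text \<open>
  Let \<open>G\<close> be the conjugate filtration of \<open>F\<close>.  The difference of \<open>\<Sum>n. dim (F\<^sup>p Gr\<^sub>n \<inter> G\<^sup>q Gr\<^sub>n)\<close> and
  \<open>dim (F\<^sup>p \<inter> G\<^sup>q)\<close> is a function \<open>g (p, q) \<ge> 0\<close>, because \<open>Gr\<^sub>n (F\<^sup>p \<inter> G\<^sup>q) \<subseteq> F\<^sup>p Gr\<^sub>n \<inter> G\<^sup>q Gr\<^sub>n\<close>.  It
  vanishes as soon as one of \<open>F\<^sup>p\<close>, \<open>G\<^sup>q\<close> is zero or everything, so it has finite support, and \<open>h - s\<close> is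
  its mixed second difference.  The mixed second difference of \<open>(p + q)\<^sup>2\<close> is the constant \<open>2\<close>,
  so two summations by parts turn the level of splitting into \<open>\<Sum>p q. g (p, q)\<close>.
\<close>

section \<open>Dimensions of sums and intersections of complex subspaces\<close>

definition finite_dim_cplx :: "'a::real_vector itself \<Rightarrow> bool" where
  "finite_dim_cplx _ \<longleftrightarrow> (\<exists>C :: ('a \<times> 'a) set. finite C \<and> cplx.span C = UNIV)"

text \<open>The locale asks for an independent spanning set; a maximal independent subset of a
  finite spanning set is one. Interpreting the locale inside a proof gives access to its dimension
  formulas.\<close>

lemma finite_dimensional_cplx:
  assumes "finite_dim_cplx TYPE('a::real_vector)"
  obtains C :: "('a::real_vector \<times> 'a) set" where "finite_dimensional_vector_space cscale C"
proof -
  obtain C :: "('a \<times> 'a) set" where C: "finite C" "cplx.span C = UNIV"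
    using assms unfolding finite_dim_cplx_def by blast
  obtain B where B: "B \<subseteq> C" "cplx.independent B" "C \<subseteq> cplx.span B"
    using cplx.maximal_independent_subset[of C] by blast
  have "finite B"
    using B C finite_subset by blast
  moreover have "cplx.span B = UNIV"
    using B C by (metis cplx.span_minimal cplx.subspace_span top.extremum_uniqueI)
  ultimately have "finite_dimensional_vector_space cscale B"
    using B(2) by unfold_locales
  then show thesis
    by (rule that)
qed

lemma set_plus_eq: "S + T = {x + y |x y. x \<in> S \<and> y \<in> T}"
  unfolding set_plus_def by blast

lemma cplx_subspace_plus:
  "cplx.subspace S \<Longrightarrow> cplx.subspace T \<Longrightarrow> cplx.subspace (S + T)"
  unfolding set_plus_eq by (rule cplx.subspace_sums)

lemma cplx_dim_plus:
  fixes S T :: "('a::real_vector \<times> 'a) set"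
  assumes fin: "finite_dim_cplx TYPE('a)" and "cplx.subspace S" "cplx.subspace T"
  shows "int (cplx.dim (S + T)) = int (cplx.dim S) + int (cplx.dim T) - int (cplx.dim (S \<inter> T))"
proof -
  obtain C :: "('a \<times> 'a) set" where "finite_dimensional_vector_space cscale C"
    using finite_dimensional_cplx[OF fin] .
  then interpret fd: finite_dimensional_vector_space "cscale :: complex \<Rightarrow> 'a \<times> 'a \<Rightarrow> _" C .
  show ?thesis
    using fd.dim_sums_Int[OF assms(2,3)] unfolding set_plus_eq by linarith
qed

lemma cplx_dim_mono:
  fixes S T :: "('a::real_vector \<times> 'a) set"
  assumes fin: "finite_dim_cplx TYPE('a)" and "S \<subseteq> T"
  shows "cplx.dim S \<le> cplx.dim T"
proof -
  obtain C :: "('a \<times> 'a) set" where "finite_dimensional_vector_space cscale C"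
    using finite_dimensional_cplx[OF fin] .
  then interpret fd: finite_dimensional_vector_space "cscale :: complex \<Rightarrow> 'a \<times> 'a \<Rightarrow> _" C .
  show ?thesis
    using fd.dim_subset[OF assms(2)] .
qed

lemma plus_absorb:
  assumes "cplx.subspace A" "S \<subseteq> A" "0 \<in> S"
  shows "S + A = A"
proof
  show "S + A \<subseteq> A"
    using assms cplx.subspace_add[OF assms(1)] by (auto simp: set_plus_def)
  show "A \<subseteq> S + A"
    using set_plus_intro[OF assms(3)] by fastforce
qed

text \<open>Modular law: subtracting the \<open>B\<close>-part from a vector of \<open>C\<close>
  stays in \<open>C\<close>.\<close>

lemma subspace_modular:
  assumes "cplx.subspace C" "B \<subseteq> C"
  shows "(S + B) \<inter> C = (S \<inter> C) + B"
proof
  show "(S + B) \<inter> C \<subseteq> (S \<inter> C) + B"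
  proof
    fix z assume z: "z \<in> (S + B) \<inter> C"
    then obtain x y where xy: "x \<in> S" "y \<in> B" "z = x + y"
      by (auto simp: set_plus_def)
    have "z - y \<in> C"
      using z xy assms cplx.subspace_diff by blast
    then show "z \<in> (S \<inter> C) + B"
      using xy by (auto intro: set_plus_intro)
  qed
  show "(S \<inter> C) + B \<subseteq> (S + B) \<inter> C"
    using assms cplx.subspace_add[OF assms(1)] by (fastforce simp: set_plus_def)
qed

section \<open>Induced subspaces and bigraded pieces of a subquotient\<close>

definition is_sq :: "'a::real_vector subquotient \<Rightarrow> bool" where
  "is_sq Q \<longleftrightarrow> cplx.subspace (fst Q) \<and> cplx.subspace (snd Q) \<and> snd Q \<subseteq> fst Q"

lemma induced_mono: "U \<subseteq> V \<Longrightarrow> induced U Q \<subseteq> induced V Q"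
  unfolding induced_def by (intro set_plus_mono2) auto

lemma induced_bounds:
  assumes "is_sq Q" "cplx.subspace U"
  shows "snd Q \<subseteq> induced U Q" and "induced U Q \<subseteq> fst Q"
proof -
  have "0 \<in> U \<inter> fst Q"
    using assms by (simp add: is_sq_def cplx.subspace_0)
  from set_plus_intro[OF this] show "snd Q \<subseteq> induced U Q"
    unfolding induced_def by fastforce
  have "x + y \<in> fst Q" if "x \<in> fst Q" "y \<in> snd Q" for x y
    using assms that cplx.subspace_add[of "fst Q"] unfolding is_sq_def by blast
  then show "induced U Q \<subseteq> fst Q"
    unfolding induced_def set_plus_def by blast
qed

lemma induced_UNIV: "is_sq Q \<Longrightarrow> induced UNIV Q = fst Q"
  unfolding induced_def is_sq_def
  by (metis add.commute cplx.subspace_0 inf_top.left_neutral plus_absorb)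

lemma induced_zero: "is_sq Q \<Longrightarrow> induced {0} Q = snd Q"
  unfolding induced_def is_sq_def
  by (metis Int_absorb2 cplx.subspace_0 empty_subsetI insert_subset plus_absorb singletonI)

lemma is_sq_gr_dec:
  assumes "is_sq Q" "decreasing_filtration F"
  shows "is_sq (gr_dec F p Q)"
proof -
  have "F (p + 1) \<subseteq> F p" and s: "\<And>p. cplx.subspace (F p)"
    using assms(2) unfolding decreasing_filtration_def by (simp_all add: antimonoD)
  then show ?thesis
    using assms(1) unfolding is_sq_def gr_dec_def
    by (simp add: induced_mono subspace_induced)
qed

text \<open>For subspaces \<open>U\<close>, \<open>V\<close> and a subquotient A / B, both induced
  subspaces contain B, so this is the dimension of their intersection in A / B. Values are integers
  so that differences can be formed freely.\<close>

definition sq_int_dim ::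
    "'a::real_vector subquotient \<Rightarrow> ('a \<times> 'a) set \<Rightarrow> ('a \<times> 'a) set \<Rightarrow> int" where
  "sq_int_dim Q U V = int (cplx.dim (induced U Q \<inter> induced V Q)) - int (cplx.dim (snd Q))"

lemma sq_int_dim_commute: "sq_int_dim Q U V = sq_int_dim Q V U"
  by (simp add: sq_int_dim_def Int_commute)

text \<open>The sign of each difference follows Gr^p = F^p / F^(p+1), so dimensions of bigraded
  pieces come out positive.\<close>

definition mixed_diff :: "(int \<Rightarrow> int \<Rightarrow> 'b::ab_group_add) \<Rightarrow> int \<Rightarrow> int \<Rightarrow> 'b" where
  "mixed_diff g p q = (g p q - g (p + 1) q) - (g p (q + 1) - g (p + 1) (q + 1))"

lemma sq_dim_diff:
  fixes Q :: "'a::real_vector subquotient"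
  assumes fin: "finite_dim_cplx TYPE('a)" and "is_sq Q"
  shows "int (sq_dim Q) = int (cplx.dim (fst Q)) - int (cplx.dim (snd Q))"
proof -
  obtain C :: "('a \<times> 'a) set" where "finite C" "cplx.span C = UNIV"
    using fin unfolding finite_dim_cplx_def by blast
  then have "sq_dim (fst Q, snd Q) = cplx.dim (fst Q) - cplx.dim (snd Q)"
    using assms(2) sq_dim_eq(3) unfolding is_sq_def by blast
  moreover have "cplx.dim (snd Q) \<le> cplx.dim (fst Q)"
    using assms(2) cplx_dim_mono[OF fin] unfolding is_sq_def by blast
  ultimately show ?thesis
    by simp
qed

lemma dim_induced:
  fixes Q :: "'a::real_vector subquotient"
  assumes "finite_dim_cplx TYPE('a)" "is_sq Q" "cplx.subspace U"
  shows "int (cplx.dim (induced U Q)) =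
    int (cplx.dim (U \<inter> fst Q)) + int (cplx.dim (snd Q)) - int (cplx.dim (U \<inter> snd Q))"
proof -
  have "U \<inter> fst Q \<inter> snd Q = U \<inter> snd Q"
    using assms(2) unfolding is_sq_def by blast
  then show ?thesis
    using assms cplx_dim_plus[OF assms(1), of "U \<inter> fst Q" "snd Q"]
    unfolding induced_def is_sq_def by (simp add: cplx.subspace_inter)
qed

text \<open>By the modular law, the intersection of the two induced subspaces is the subspace that
  \<open>V\<close> induces on the smaller subquotient \<open>(induced U Q, snd Q)\<close>. This
  asymmetric form fits graded pieces taken one after the other.\<close>

lemma sq_int_dim_alt:
  fixes Q :: "'a::real_vector subquotient"
  assumes "finite_dim_cplx TYPE('a)" "is_sq Q" "cplx.subspace U" "cplx.subspace V"
  shows "sq_int_dim Q U V =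
    int (cplx.dim (V \<inter> induced U Q)) - int (cplx.dim (V \<inter> snd Q))"
proof -
  have s: "cplx.subspace (induced U Q)"
    using assms by (auto simp: is_sq_def intro: subspace_induced)
  have sq: "is_sq (induced U Q, snd Q)"
    using s induced_bounds(1)[OF assms(2,3)] assms(2) by (simp add: is_sq_def)
  have "induced V Q \<inter> induced U Q = (V \<inter> fst Q \<inter> induced U Q) + snd Q"
    unfolding induced_def[of V Q]
    by (intro subspace_modular s induced_bounds(1) assms)
  also have "V \<inter> fst Q \<inter> induced U Q = V \<inter> induced U Q"
    using induced_bounds(2)[OF assms(2,3)] by blast
  finally have "induced U Q \<inter> induced V Q = induced V (induced U Q, snd Q)"
    by (simp add: induced_def Int_commute)
  then show ?thesis
    using dim_induced[OF assms(1) sq assms(4)] by (simp add: sq_int_dim_def)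
qed

text \<open>Both layers of the inner graded piece contribute a term from
  \<open>sq_int_dim_alt\<close>, and the terms with \<open>snd Q\<close> cancel. As
  \<open>sq_int_dim\<close> is symmetric, the two orders of grading give the same dimension.\<close>

lemma sq_dim_gr_gr:
  fixes Q :: "'a::real_vector subquotient"
  assumes fin: "finite_dim_cplx TYPE('a)" and Q: "is_sq Q"
    and F: "decreasing_filtration F" and G: "decreasing_filtration G"
  shows "int (sq_dim (gr_dec G q (gr_dec F p Q))) =
    mixed_diff (\<lambda>p q. sq_int_dim Q (F p) (G q)) p q"
proof -
  have sF: "\<And>p. cplx.subspace (F p)" and sG: "\<And>p. cplx.subspace (G p)"
    using F G unfolding decreasing_filtration_def by auto
  have sq: "is_sq (gr_dec F p Q)"
    by (intro is_sq_gr_dec Q F)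
  show ?thesis
    using sq_dim_diff[OF fin is_sq_gr_dec[OF sq G, of q]]
      dim_induced[OF fin sq sG, of q] dim_induced[OF fin sq sG, of "q + 1"]
    by (simp add: gr_dec_def mixed_diff_def sq_int_dim_alt[OF fin Q sF sG])
qed

text \<open>
  The dimension of \<open>(U\<^sub>Q \<inter> V\<^sub>Q) / (U \<inter> V)\<^sub>Q\<close>, where the index denotes the induced subspace of \<open>Q\<close>.
\<close>

definition sq_excess ::
    "'a::real_vector subquotient \<Rightarrow> ('a \<times> 'a) set \<Rightarrow> ('a \<times> 'a) set \<Rightarrow> int" where
  "sq_excess Q U V =
     int (cplx.dim (induced U Q \<inter> induced V Q)) - int (cplx.dim (induced (U \<inter> V) Q))"

lemma sq_excess_commute: "sq_excess Q U V = sq_excess Q V U"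
  by (simp add: sq_excess_def Int_commute)

lemma sq_excess_nonneg:
  fixes Q :: "'a::real_vector subquotient"
  assumes "finite_dim_cplx TYPE('a)"
  shows "sq_excess Q U V \<ge> 0"
proof -
  have "induced (U \<inter> V) Q \<subseteq> induced U Q \<inter> induced V Q"
    by (simp add: induced_mono)
  from cplx_dim_mono[OF assms this] show ?thesis
    by (simp add: sq_excess_def)
qed

lemma sq_excess_trivial:
  assumes "is_sq Q" "cplx.subspace V" "U = UNIV \<or> U = {0}"
  shows "sq_excess Q U V = 0" "sq_excess Q V U = 0"
proof -
  show "sq_excess Q U V = 0"
    using assms(3)
  proof
    assume "U = UNIV"
    then show ?thesis
      using induced_bounds(2)[OF assms(1,2)]
      by (simp add: sq_excess_def induced_UNIV[OF assms(1)] Int_absorb1)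
  next
    assume U: "U = {0}"
    then have "U \<inter> V = {0}"
      using cplx.subspace_0[OF assms(2)] by blast
    then show ?thesis
      using induced_bounds(1)[OF assms(1,2)] U
      by (simp add: sq_excess_def induced_zero[OF assms(1)] Int_absorb2)
  qed
  then show "sq_excess Q V U = 0"
    by (simp add: sq_excess_commute)
qed

text \<open>The bracket is the dimension of the subspace that \<open>U \<inter> V\<close> induces on
  \<open>Q\<close>. For the pieces of a weight filtration it telescopes over the weights.\<close>

lemma sq_int_dim_excess:
  fixes Q :: "'a::real_vector subquotient"
  assumes "finite_dim_cplx TYPE('a)" "is_sq Q" "cplx.subspace U" "cplx.subspace V"
  shows "sq_int_dim Q U V =
    sq_excess Q U V + (int (cplx.dim (U \<inter> V \<inter> fst Q)) - int (cplx.dim (U \<inter> V \<inter> snd Q)))"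
  using dim_induced[OF assms(1,2) cplx.subspace_inter[OF assms(3,4)]]
  by (simp add: sq_int_dim_def sq_excess_def)

section \<open>Summation by parts over integer intervals\<close>

lemma sum_int_telescope:
  fixes f :: "int \<Rightarrow> 'b::ab_group_add"
  assumes "a \<le> b"
  shows "(\<Sum>n\<in>{a<..b}. f n - f (n - 1)) = f b - f a"
  using assms
proof (induction b rule: int_ge_induct)
  case (step b)
  have "{a<..b + 1} = insert (b + 1) {a<..b}"
    using step by auto
  then show ?case
    using step by simp
qed simp

lemma sum_by_parts:
  fixes u \<phi> :: "int \<Rightarrow> 'b::comm_ring_1"
  assumes "u a = 0" "u (b + 1) = 0"
  shows "(\<Sum>p\<in>{a..b}. \<phi> p * (u p - u (p + 1))) = (\<Sum>p\<in>{a..b}. (\<phi> p - \<phi> (p - 1)) * u p)"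
proof (cases "a \<le> b")
  case True
  \<comment> \<open>The two summands differ by exactly \<open>?f p - ?f (p - 1)\<close> up to sign,
    and the boundary values of \<open>?f\<close> at \<open>b\<close> and \<open>a - 1\<close> vanish
    with \<open>u (b + 1)\<close> and \<open>u a\<close>.\<close>
  let ?f = "\<lambda>n. \<phi> n * u (n + 1)"
  have "(\<Sum>n\<in>{a - 1<..b}. ?f n - ?f (n - 1)) = ?f b - ?f (a - 1)"
    using True by (intro sum_int_telescope) simp
  moreover have "{a - 1<..b} = {a..b}"
    by auto
  ultimately have "(\<Sum>n\<in>{a..b}. ?f n - ?f (n - 1)) = 0"
    using assms by simp
  then show ?thesis
    by (simp add: algebra_simps sum_subtractf)
qed simp

text \<open>Summing by parts in \<open>q\<close> replaces the square by
  \<open>2 * (p + q) - 1\<close>; doing so in \<open>p\<close> leaves the constant 2. The support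
  condition includes the edge \<open>p = a\<close> or \<open>q = a\<close>, where the lower boundary
  terms must vanish.\<close>

lemma sum_square_mixed_diff:
  fixes g :: "int \<Rightarrow> int \<Rightarrow> int"
  assumes "\<And>p q. p \<le> a \<or> p > b \<or> q \<le> a \<or> q > b \<Longrightarrow> g p q = 0"
  shows "(\<Sum>p\<in>{a..b}. \<Sum>q\<in>{a..b}. (p + q)\<^sup>2 * mixed_diff g p q) =
    2 * (\<Sum>p\<in>{a..b}. \<Sum>q\<in>{a..b}. g p q)"
proof -
  have "(\<Sum>p\<in>{a..b}. \<Sum>q\<in>{a..b}. (p + q)\<^sup>2 * mixed_diff g p q) =
      (\<Sum>p\<in>{a..b}. \<Sum>q\<in>{a..b}. ((p + q)\<^sup>2 - (p + (q - 1))\<^sup>2) * (g p q - g (p + 1) q))"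
    unfolding mixed_diff_def
    by (intro sum.cong refl sum_by_parts[where u = "\<lambda>q. g _ q - g (_ + 1) q"]) (simp_all add: assms)
  also have "\<dots> = (\<Sum>p\<in>{a..b}. \<Sum>q\<in>{a..b}. (2 * (p + q) - 1) * (g p q - g (p + 1) q))"
    by (intro sum.cong refl) (simp add: power2_eq_square algebra_simps)
  also have "\<dots> = (\<Sum>q\<in>{a..b}. \<Sum>p\<in>{a..b}. (2 * (p + q) - 1) * (g p q - g (p + 1) q))"
    by (rule sum.swap)
  also have "\<dots> = (\<Sum>q\<in>{a..b}. \<Sum>p\<in>{a..b}. ((2 * (p + q) - 1) - (2 * (p - 1 + q) - 1)) * g p q)"
    by (intro sum.cong refl sum_by_parts) (simp_all add: assms)
  also have "\<dots> = 2 * (\<Sum>q\<in>{a..b}. \<Sum>p\<in>{a..b}. g p q)"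
    by (simp add: sum_distrib_left)
  also have "(\<Sum>q\<in>{a..b}. \<Sum>p\<in>{a..b}. g p q) = (\<Sum>p\<in>{a..b}. \<Sum>q\<in>{a..b}. g p q)"
    by (rule sum.swap)
  finally show ?thesis .
qed

section \<open>Hodge numbers as mixed differences\<close>

lemma decreasing_filtration_trivial:
  assumes "decreasing_filtration F"
  obtains a b where "\<And>p. p \<le> a \<or> p > b \<Longrightarrow> F p = UNIV \<or> F p = {0}"
proof -
  from assms obtain a b where ab: "F a = UNIV" "F b = {0}" and anti: "antimono F"
    and sub: "\<And>p. cplx.subspace (F p)"
    unfolding decreasing_filtration_def by blast
  have "F p = UNIV" if "p \<le> a" for p
    using antimonoD[OF anti that] ab by blast
  moreover have "F p = {0}" if "p > b" for p
    using antimonoD[OF anti, of b p] that ab cplx.subspace_0[OF sub[of p]] by force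
  ultimately show thesis
    using that[of a b] by blast
qed

lemma gr_W_eq: "gr_W W n = (complexify (W n), complexify (W (n - 1)))"
  by (simp add: gr_W_def gr_inc_def induced_def whole_def set_plus_def)

lemma is_sq_gr_W:
  assumes "increasing_filtration W"
  shows "is_sq (gr_W W n)"
proof -
  have "W (n - 1) \<subseteq> W n" "\<And>n. subspace (W n)"
    using assms unfolding increasing_filtration_def by (simp_all add: monoD)
  then show ?thesis
    by (auto simp: is_sq_def gr_W_eq subspace_complexify) (auto simp: complexify_def)
qed

lemma is_sq_whole: "is_sq whole"
  by (auto simp: is_sq_def whole_def cplx.subspace_UNIV cplx.subspace_single_0)

lemma induced_whole: "induced U whole = U"
  by (simp add: induced_def whole_def set_plus_def)

lemma cplx_dim_zero: "cplx.dim {0} = 0"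
  by (metis cplx.dim_span cplx.span_empty cplx.dim_eq_card_independent
      cplx.independent_empty card.empty)

lemma increasing_filtration_bounds:
  assumes "increasing_filtration W"
  obtains a b where "a \<le> b" "\<And>n. n \<le> a \<Longrightarrow> W n = {0}" "\<And>n. n \<ge> b \<Longrightarrow> W n = UNIV"
proof -
  from assms obtain a b where ab: "W a = {0}" "W b = UNIV" and mono: "mono W"
    and sub: "\<And>n. subspace (W n)"
    unfolding increasing_filtration_def by blast
  have l: "W n = {0}" if "n \<le> a" for n
    using monoD[OF mono that] ab subspace_0[OF sub[of n]] by blast
  have "W n = UNIV" if "n \<ge> b" for n
    using monoD[OF mono that] ab by blast
  then show thesis
    \<comment> \<open>In the zero space a weight with \<open>W n = {0}\<close> may lie above one
      with \<open>W n = UNIV\<close>; the minimum restores the order.\<close>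
    using that[of "min a b" b] l by simp
qed

lemma hodge_s_mixed_diff:
  fixes F :: "int \<Rightarrow> ('a::real_vector \<times> 'a) set"
  assumes fin: "finite_dim_cplx TYPE('a)" and F: "decreasing_filtration F"
  shows "int (hodge_s F p q) =
    mixed_diff (\<lambda>p q. int (cplx.dim (F p \<inter> conj_filtration F q))) p q"
  unfolding hodge_s_def sq_dim_gr_gr[OF fin is_sq_whole decreasing_filtration_conj[OF F] F]
  by (simp add: mixed_diff_def sq_int_dim_def induced_whole Int_commute[of "conj_filtration F _" "F _"])

text \<open>The Hodge condition kills every weight other than \<open>p + q\<close>, so the single
  term defining \<open>hodge_h\<close> may be replaced by a sum over a range of weights independent
  of \<open>p\<close> and \<open>q\<close>. Telescoping in the weight then becomes possible.\<close>

lemma hodge_h_mixed_diff: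
  fixes F :: "int \<Rightarrow> ('a::real_vector \<times> 'a) set"
  assumes H: "real_mixed_hodge_structure W F" and fin: "finite_dim_cplx TYPE('a)"
    and ab: "\<And>n. n \<le> a \<Longrightarrow> W n = {0}" "\<And>n. n \<ge> b \<Longrightarrow> W n = UNIV"
  shows "int (hodge_h W F p q) =
    (\<Sum>n\<in>{a<..b}. mixed_diff (\<lambda>p q. sq_int_dim (gr_W W n) (F p) (conj_filtration F q)) p q)"
proof -
  let ?G = "conj_filtration F"
  let ?d = "\<lambda>n. mixed_diff (\<lambda>p q. sq_int_dim (gr_W W n) (F p) (?G q)) p q"
  have F: "decreasing_filtration F" and W: "increasing_filtration W"
    and van: "\<And>n. p + q \<noteq> n \<Longrightarrow> sq_zero (gr_dec F p (gr_dec ?G q (gr_W W n)))"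
    using H unfolding real_mixed_hodge_structure_def by auto
  note G = decreasing_filtration_conj[OF F]
  note sq = is_sq_gr_W[OF W]
  have sF: "\<And>p. cplx.subspace (F p)" and sG: "\<And>p. cplx.subspace (?G p)"
    using F G unfolding decreasing_filtration_def by auto
  have h: "int (hodge_h W F p q) = ?d (p + q)"
    unfolding hodge_h_def by (rule sq_dim_gr_gr[OF fin sq F G])
  \<comment> \<open>Both orders of taking graded pieces yield the same dimension, which lets the vanishing condition apply.\<close>
  have off: "?d n = 0" if "n \<noteq> p + q" for n
  proof -
    have "is_sq (gr_dec F p (gr_dec ?G q (gr_W W n)))"
      by (intro is_sq_gr_dec sq F G)
    then have "sq_dim (gr_dec F p (gr_dec ?G q (gr_W W n))) = 0"
      using van[of n] that sq_dim_zero unfolding is_sq_def by metis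
    then show ?thesis
      using sq_dim_gr_gr[OF fin sq G F, of p q n]
      by (simp add: mixed_diff_def sq_int_dim_commute[of _ "?G _"])
  qed
  \<comment> \<open>This covers the case where \<open>p + q\<close> itself lies outside the range:
    the sum is then zero, and so is the Hodge number, since the graded piece of \<open>W\<close> is
    zero.\<close>
  have out: "?d n = 0" if "n \<notin> {a<..b}" for n
  proof -
    have "W n = W (n - 1)"
      using that ab by (cases "n \<le> a") auto
    then have "fst (gr_W W n) = snd (gr_W W n)"
      by (simp add: gr_W_eq)
    then have "induced U (gr_W W n) = snd (gr_W W n)" if "cplx.subspace U" for U
      using induced_bounds[OF sq that, of n] by auto
    then show ?thesis
      by (simp add: mixed_diff_def sq_int_dim_def sF sG)
  qed
  have "(\<Sum>n\<in>{a<..b}. ?d n) = (\<Sum>n\<in>{a<..b}. if n = p + q then ?d (p + q) else 0)"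
    by (intro sum.cong) (auto simp: off)
  also have "\<dots> = ?d (p + q)"
    using out[of "p + q"] by (simp add: sum.delta)
  finally show ?thesis
    using h by simp
qed

lemma mixed_diff_sum:
  "(\<Sum>n\<in>A. mixed_diff (g n) p q) = mixed_diff (\<lambda>p q. \<Sum>n\<in>A. g n p q) p q"
  by (simp add: mixed_diff_def sum_subtractf)

text \<open>Split each weight's intersection dimension into its excess and the part coming from
  \<open>F p \<inter> conj_filtration F q\<close>. The latter parts add up to the full dimension of
  that intersection, whose mixed difference is \<open>hodge_s\<close>; only the excess
  survives.\<close>

lemma hodge_h_minus_s:
  fixes F :: "int \<Rightarrow> ('a::real_vector \<times> 'a) set"
  assumes H: "real_mixed_hodge_structure W F" and fin: "finite_dim_cplx TYPE('a)"
    and "a \<le> b" and ab: "\<And>n. n \<le> a \<Longrightarrow> W n = {0}" "\<And>n. n \<ge> b \<Longrightarrow> W n = UNIV"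
  shows "int (hodge_h W F p q) - int (hodge_s F p q) =
    mixed_diff (\<lambda>p q. \<Sum>n\<in>{a<..b}. sq_excess (gr_W W n) (F p) (conj_filtration F q)) p q"
proof -
  let ?G = "conj_filtration F"
  have F: "decreasing_filtration F" and W: "increasing_filtration W"
    using H unfolding real_mixed_hodge_structure_def by auto
  have sF: "\<And>p. cplx.subspace (F p)" and sG: "\<And>p. cplx.subspace (?G p)"
    using F decreasing_filtration_conj[OF F] unfolding decreasing_filtration_def by auto
  have total: "(\<Sum>n\<in>{a<..b}. sq_int_dim (gr_W W n) (F p) (?G q)) =
      (\<Sum>n\<in>{a<..b}. sq_excess (gr_W W n) (F p) (?G q)) + int (cplx.dim (F p \<inter> ?G q))" for p q
  proof -
    \<comment> \<open>The weight filtration cuts the intersection into steps, from zero at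
      \<open>a\<close> to all of it at \<open>b\<close>.\<close>
    let ?f = "\<lambda>n. int (cplx.dim (F p \<inter> ?G q \<inter> complexify (W n)))"
    have "F p \<inter> ?G q \<inter> complexify (W a) = {0}"
      using cplx.subspace_0[OF sF[of p]] cplx.subspace_0[OF sG[of q]]
      by (auto simp: ab complexify_def zero_prod_def)
    moreover have "F p \<inter> ?G q \<inter> complexify (W b) = F p \<inter> ?G q"
      by (auto simp: ab complexify_def)
    ultimately have "(\<Sum>n\<in>{a<..b}. ?f n - ?f (n - 1)) = int (cplx.dim (F p \<inter> ?G q))"
      using sum_int_telescope[OF \<open>a \<le> b\<close>, of ?f] by (simp add: cplx_dim_zero)
    then show ?thesis
      unfolding sq_int_dim_excess[OF fin is_sq_gr_W[OF W] sF sG] sum.distrib by (simp add: gr_W_eq)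
  qed
  show ?thesis
    by (simp add: hodge_h_mixed_diff[OF H fin ab] hodge_s_mixed_diff[OF fin F] mixed_diff_sum total)
      (simp add: mixed_diff_def)
qed

theorem mainTheorem9:
  fixes W :: "int \<Rightarrow> 'a::real_vector set" and F :: "int \<Rightarrow> ('a \<times> 'a) set"
  assumes "real_mixed_hodge_structure W F"
  shows "R_splitting_level W F \<ge> 0"
proof -
  let ?G = "conj_filtration F"
  have F: "decreasing_filtration F" and W: "increasing_filtration W"
    and fin: "finite_dim_cplx TYPE('a)"
    using assms finite_complexification
    unfolding real_mixed_hodge_structure_def finite_dim_cplx_def by blast+
  note G = decreasing_filtration_conj[OF F]
  have sF: "\<And>p. cplx.subspace (F p)" and sG: "\<And>p. cplx.subspace (?G p)"
    using F G unfolding decreasing_filtration_def by auto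
  obtain a b where ab: "a \<le> b" "\<And>n. n \<le> a \<Longrightarrow> W n = {0}" "\<And>n. n \<ge> b \<Longrightarrow> W n = UNIV"
    using increasing_filtration_bounds[OF W] by blast
  define g where "g p q = (\<Sum>n\<in>{a<..b}. sq_excess (gr_W W n) (F p) (?G q))" for p q
  have hs: "int (hodge_h W F p q) - int (hodge_s F p q) = mixed_diff g p q" for p q
    using hodge_h_minus_s[OF assms fin ab] unfolding g_def by simp
  define S where "S = {(p, q). hodge_h W F p q \<noteq> 0 \<or> hodge_s F p q \<noteq> 0}"
  have "finite S"
    unfolding S_def by (rule finite_hodge_support[OF assms])
  obtain a1 b1 where F1: "\<And>p. p \<le> a1 \<or> p > b1 \<Longrightarrow> F p = UNIV \<or> F p = {0}"
    using decreasing_filtration_trivial[OF F] by blast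
  obtain a2 b2 where G2: "\<And>p. p \<le> a2 \<or> p > b2 \<Longrightarrow> ?G p = UNIV \<or> ?G p = {0}"
    using decreasing_filtration_trivial[OF G] by blast
  \<comment> \<open>One interval serves both variables: its square contains the support of both
    kinds of Hodge numbers, and it reaches far enough for both filtrations to be trivial
    outside.\<close>
  define X where "X = {a1, b1, a2, b2} \<union> fst ` S \<union> snd ` S"
  have X: "finite X"
    using \<open>finite S\<close> by (simp add: X_def)
  define c d where "c = Min X" and "d = Max X"
  have box: "x \<in> {c..d}" if "x \<in> X" for x
    using X that by (simp add: c_def d_def)
  have bounds: "c \<le> a1" "b1 \<le> d" "c \<le> a2" "b2 \<le> d"
    using box by (simp_all add: X_def)
  have S_box: "S \<subseteq> {c..d} \<times> {c..d}"
  proof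
    fix x assume "x \<in> S"
    then have "fst x \<in> X" "snd x \<in> X"
      by (auto simp: X_def)
    then show "x \<in> {c..d} \<times> {c..d}"
      using box by (cases x) auto
  qed
  \<comment> \<open>One trivial filtration step suffices for every excess to vanish. The lower edge
    \<open>c\<close> is included, as the summation by parts demands.\<close>
  have g0: "g p q = 0" if "p \<le> c \<or> p > d \<or> q \<le> c \<or> q > d" for p q
  proof -
    have "(F p = UNIV \<or> F p = {0}) \<or> (?G q = UNIV \<or> ?G q = {0})"
      using that F1[of p] G2[of q] bounds by linarith
    then show ?thesis
      unfolding g_def
      using sq_excess_trivial[OF is_sq_gr_W[OF W]] sF sG by (metis (no_types, lifting) sum.neutral)
  qed
  have "(\<Sum>(p, q)\<in>S. (p + q)\<^sup>2 * (int (hodge_h W F p q) - int (hodge_s F p q))) =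
      (\<Sum>(p, q)\<in>{c..d} \<times> {c..d}. (p + q)\<^sup>2 * (int (hodge_h W F p q) - int (hodge_s F p q)))"
    using S_box by (intro sum.mono_neutral_left) (auto simp: S_def)
  also have "\<dots> = (\<Sum>p\<in>{c..d}. \<Sum>q\<in>{c..d}. (p + q)\<^sup>2 * mixed_diff g p q)"
    by (simp add: sum.cartesian_product hs)
  also have "\<dots> = 2 * (\<Sum>p\<in>{c..d}. \<Sum>q\<in>{c..d}. g p q)"
    by (rule sum_square_mixed_diff[OF g0])
  also have "\<dots> \<ge> 0"
    unfolding g_def by (intro mult_nonneg_nonneg sum_nonneg sq_excess_nonneg[OF fin]) simp
  finally have "0 \<le> (\<Sum>(p, q)\<in>S. (p + q)\<^sup>2 * (int (hodge_h W F p q) - int (hodge_s F p q)))" .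
  \<comment> \<open>The computation so far is in the integers; the cast leads to the real-valued
    level, whose factor 1/2 accounts for the 2 below.\<close>
  then have "0 \<le> real_of_int (\<Sum>(p, q)\<in>S. (p + q)\<^sup>2 * (int (hodge_h W F p q) - int (hodge_s F p q)))"
    by (simp only: of_int_0_le_iff)
  also have "\<dots> = 2 * R_splitting_level W F"
    by (simp add: R_splitting_level_def S_def case_prod_unfold)
  finally show ?thesis
    by simp
qed

end
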